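(* Let $\{X_{n}\}_{n=1}^{\infty}$ be a sequence of pairwise independent random variables, and let $\{a_{n}\}_{n=1}^{\infty}$ be a non-decreasing unbounded sequence of positive numbers. For $x \geq 0$ put $$G(x) = \sup_{n \geq 1} \frac{1}{a_{n}} \sum_{k=1}^{n} P(|X_{k}| > x).$$ Suppose that $$\int_{0}^{\infty} G(x) \, dx < \infty \qquad \text{and} \qquad \sum_{n=1}^{\infty} P(|X_{n}| > a_{n}) < \infty.$$ Then $$\frac{S_{n} - ES_{n}}{a_{n}} \to 0 \quad \text{almost surely as } n \to \infty.$$
   Context: The random variables $X_n$, $n \geq 1$, are real-valued and defined on the same probability space; they are not assumed identically distributed. $S_{n}=\sum_{k=1}^{n} X_{k}$, $P$ denotes probability and $E$ denotes expectation. *)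

theory Defs
  imports "HOL-Probability.Probability"
begin

(* Sequences are indexed from 1; the values at index 0 are irrelevant. *)

definition partial_sum :: "(nat \<Rightarrow> 'a \<Rightarrow> real) \<Rightarrow> nat \<Rightarrow> 'a \<Rightarrow> real" where
  "partial_sum X n \<omega> = (\<Sum>k=1..n. X k \<omega>)"

(* Extended-valued: the supremum may be infinite at some x. *)
definition tail_sup :: "'a measure \<Rightarrow> (nat \<Rightarrow> 'a \<Rightarrow> real) \<Rightarrow> (nat \<Rightarrow> real) \<Rightarrow> real \<Rightarrow> ennreal" where
  "tail_sup M X a x =
     (SUP n\<in>{1..}. ennreal (1 / a n * (\<Sum>k=1..n. \<P>(\<omega> in M. \<bar>X k \<omega>\<bar> > x))))"

end

theory Submission
  imports Defs
begin

text \<open>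
  Splitting each variable into positive and negative part reduces to non-negative \<open>X\<close>.
  These are truncated at their own level, \<open>Y k = X k 1{X k \<le> a k}\<close>, with sums \<open>T n\<close>: by Borel--Cantelli
  this does not affect the limit of \<open>S n / a n\<close>, and the error in the means is controlled by
  the tails of \<open>\<Sum> P(X k > a k)\<close> and of the integral of \<open>G\<close>. For \<open>T\<close> one argues as in Etemadi's proof,
  along the dyadic blocks \<open>2^m \<le> a n < 2^(m+1)\<close>. Within a block the mean \<open>E (T n)\<close> need not be nearly
  constant, but it is at most \<open>a n\<close> times the integral of \<open>G\<close>, so the block splits into a number of
  pieces independent of \<open>m\<close> on which \<open>E (T n)\<close> varies by at most \<open>\<epsilon> 2^m\<close>.
  By monotonicity only the end points of the pieces matter. Pairwise independence and the layer-cake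
  formula give the variance bound \<open>\<integral> 2x 2^(m+1) G(x) dx\<close> over \<open>0 \<le> x < 2^(m+1)\<close> at these points, and
  after division by \<open>4^m\<close> the bounds sum over \<open>m\<close> to a multiple of the integral of \<open>G\<close>.
\<close>

section \<open>Layer-cake formulas and variance\<close>

lemma sum_nn_integral_eq_integral:
  fixes f :: "'i \<Rightarrow> 'a \<Rightarrow> real"
  assumes "\<And>i. i \<in> I \<Longrightarrow> integrable M (f i)" "\<And>i \<omega>. i \<in> I \<Longrightarrow> 0 \<le> f i \<omega>"
  shows "(\<Sum>i\<in>I. \<integral>\<^sup>+\<omega>. ennreal (f i \<omega>) \<partial>M) = ennreal (\<Sum>i\<in>I. \<integral>\<omega>. f i \<omega> \<partial>M)"
proof -
  have "(\<Sum>i\<in>I. \<integral>\<^sup>+\<omega>. ennreal (f i \<omega>) \<partial>M) = (\<Sum>i\<in>I. ennreal (\<integral>\<omega>. f i \<omega> \<partial>M))"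
    using assms by (intro sum.cong refl nn_integral_eq_integral) auto
  also have "\<dots> = ennreal (\<Sum>i\<in>I. \<integral>\<omega>. f i \<omega> \<partial>M)"
    using assms by (intro sum_ennreal) simp
  finally show ?thesis .
qed

text \<open>Monotone functions on the line are Borel. The tail is non-increasing, so the argument
  goes through its negative and back.\<close>

lemma (in prob_space) borel_measurable_tail [measurable]:
  fixes X :: "'a \<Rightarrow> real"
  assumes [measurable]: "X \<in> borel_measurable M"
  shows "(\<lambda>x. emeasure M {\<omega>\<in>space M. x < X \<omega>}) \<in> borel_measurable borel"
proof -
  have "mono (\<lambda>x. - prob {\<omega>\<in>space M. x < X \<omega>})"
    by (intro monoI) (auto intro!: finite_measure_mono)
  then have "(\<lambda>x. - (- prob {\<omega>\<in>space M. x < X \<omega>})) \<in> borel_measurable borel"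
    by (intro borel_measurable_uminus borel_measurable_mono)
  then show ?thesis by (simp add: emeasure_eq_measure)
qed

text \<open>Tonelli on the region \<open>0 \<le> x < X \<omega>\<close>. The weight \<open>h\<close>
  is left free so that an indicator of \<open>{c..}\<close> yields the mean excess over
  \<open>c\<close>, and \<open>2 * x\<close> cut off at \<open>c\<close> yields a truncated second
  moment.\<close>

lemma (in prob_space) nn_integral_layer_cake:
  fixes X :: "'a \<Rightarrow> real" and h :: "real \<Rightarrow> ennreal"
  assumes [measurable]: "X \<in> borel_measurable M" "h \<in> borel_measurable borel"
  shows "(\<integral>\<^sup>+\<omega>. (\<integral>\<^sup>+x\<in>{0..<X \<omega>}. h x \<partial>lborel) \<partial>M) =
    (\<integral>\<^sup>+x\<in>{0..}. h x * emeasure M {\<omega>\<in>space M. x < X \<omega>} \<partial>lborel)"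
proof -
  interpret pair_sigma_finite M lborel
    by (intro pair_sigma_finite.intro sigma_finite_measure_axioms lborel.sigma_finite_measure_axioms)
  let ?f = "\<lambda>\<omega> x. h x * indicator {0..} x * (if x < X \<omega> then 1 else 0 :: ennreal)"
  have "(\<integral>\<^sup>+\<omega>. (\<integral>\<^sup>+x\<in>{0..<X \<omega>}. h x \<partial>lborel) \<partial>M) = (\<integral>\<^sup>+\<omega>. (\<integral>\<^sup>+x. ?f \<omega> x \<partial>lborel) \<partial>M)"
    by (intro nn_integral_cong) (auto simp: indicator_def)
  also have "\<dots> = (\<integral>\<^sup>+x. (\<integral>\<^sup>+\<omega>. ?f \<omega> x \<partial>M) \<partial>lborel)"
    by (rule Fubini'[symmetric]) measurable
  also have "\<dots> = (\<integral>\<^sup>+x\<in>{0..}. h x * emeasure M {\<omega>\<in>space M. x < X \<omega>} \<partial>lborel)"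
  proof (rule nn_integral_cong)
    fix x :: real
    have "(\<integral>\<^sup>+\<omega>. ?f \<omega> x \<partial>M) = h x * indicator {0..} x * (\<integral>\<^sup>+\<omega>. (if x < X \<omega> then 1 else 0) \<partial>M)"
      by (rule nn_integral_cmult) measurable
    also have "(\<integral>\<^sup>+\<omega>. (if x < X \<omega> then 1 else 0 :: ennreal) \<partial>M) =
      (\<integral>\<^sup>+\<omega>. indicator {\<omega>\<in>space M. x < X \<omega>} \<omega> \<partial>M)"
      by (intro nn_integral_cong) (auto simp: indicator_def)
    also have "\<dots> = emeasure M {\<omega>\<in>space M. x < X \<omega>}"
      by (rule nn_integral_indicator) measurable
    finally show "(\<integral>\<^sup>+\<omega>. ?f \<omega> x \<partial>M) = h x * emeasure M {\<omega>\<in>space M. x < X \<omega>} * indicator {0..} x"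
      by (simp add: mult_ac)
  qed
  finally show ?thesis .
qed

text \<open>Since \<open>ennreal\<close> sends negative reals to 0, the left side is the mean of the
  positive part of \<open>X - c\<close>. Level \<open>c = 0\<close> serves for the means, large
  \<open>c\<close> for the truncation bias.\<close>

lemma (in prob_space) nn_integral_excess_eq_tail:
  fixes X :: "'a \<Rightarrow> real"
  assumes [measurable]: "X \<in> borel_measurable M" and "c \<ge> 0"
  shows "(\<integral>\<^sup>+\<omega>. ennreal (X \<omega> - c) \<partial>M) = (\<integral>\<^sup>+x\<in>{c..}. emeasure M {\<omega>\<in>space M. x < X \<omega>} \<partial>lborel)"
proof -
  have "(\<integral>\<^sup>+\<omega>. ennreal (X \<omega> - c) \<partial>M) = (\<integral>\<^sup>+\<omega>. (\<integral>\<^sup>+x\<in>{0..<X \<omega>}. indicator {c..} x \<partial>lborel) \<partial>M)"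
  proof (rule nn_integral_cong)
    fix \<omega>
    have "(\<integral>\<^sup>+x\<in>{0..<X \<omega>}. indicator {c..} x \<partial>lborel) = (\<integral>\<^sup>+x. indicator {c..<X \<omega>} x \<partial>lborel)"
      using \<open>c \<ge> 0\<close> by (intro nn_integral_cong) (auto simp: indicator_def)
    then show "ennreal (X \<omega> - c) = (\<integral>\<^sup>+x\<in>{0..<X \<omega>}. indicator {c..} x \<partial>lborel)"
      by (cases "c \<le> X \<omega>") (auto simp: ennreal_neg)
  qed
  also have "\<dots> = (\<integral>\<^sup>+x\<in>{0..}. indicator {c..} x * emeasure M {\<omega>\<in>space M. x < X \<omega>} \<partial>lborel)"
    by (rule nn_integral_layer_cake) measurable
  also have "\<dots> = (\<integral>\<^sup>+x\<in>{c..}. emeasure M {\<omega>\<in>space M. x < X \<omega>} \<partial>lborel)"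
    using \<open>c \<ge> 0\<close> by (intro nn_integral_cong) (auto simp: indicator_def)
  finally show ?thesis .
qed

text \<open>Where \<open>X \<le> b\<close>, the square is the integral of \<open>2 * x\<close> over
  \<open>{0..<X \<omega>}\<close>, a range inside \<open>{..<c}\<close> because
  \<open>b \<le> c\<close>; elsewhere the left side vanishes. Separating \<open>c\<close> from
  \<open>b\<close> later allows one cut-off for variables truncated at different levels.\<close>

lemma (in prob_space) nn_integral_truncated_square_le_tail:
  fixes X :: "'a \<Rightarrow> real"
  assumes [measurable]: "X \<in> borel_measurable M" and X: "\<And>\<omega>. 0 \<le> X \<omega>" and "b \<le> c"
  shows "(\<integral>\<^sup>+\<omega>. ennreal ((if X \<omega> \<le> b then X \<omega> else 0)\<^sup>2) \<partial>M) \<le>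
    (\<integral>\<^sup>+x\<in>{0..<c}. ennreal (2 * x) * emeasure M {\<omega>\<in>space M. x < X \<omega>} \<partial>lborel)"
proof -
  have "(\<integral>\<^sup>+\<omega>. ennreal ((if X \<omega> \<le> b then X \<omega> else 0)\<^sup>2) \<partial>M) \<le>
    (\<integral>\<^sup>+\<omega>. (\<integral>\<^sup>+x\<in>{0..<X \<omega>}. ennreal (2 * x) * indicator {..<c} x \<partial>lborel) \<partial>M)"
  proof (rule nn_integral_mono)
    fix \<omega>
    show "ennreal ((if X \<omega> \<le> b then X \<omega> else 0)\<^sup>2) \<le>
      (\<integral>\<^sup>+x\<in>{0..<X \<omega>}. ennreal (2 * x) * indicator {..<c} x \<partial>lborel)"
    proof (cases "X \<omega> \<le> b")
      case True
      have "(\<integral>\<^sup>+x. ennreal (2 * x) * indicator {0..X \<omega>} x \<partial>lborel) = ennreal ((X \<omega>)\<^sup>2 - 0\<^sup>2)"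
        using X by (intro nn_integral_FTC_Icc) (auto intro!: derivative_eq_intros)
      also have "(\<integral>\<^sup>+x. ennreal (2 * x) * indicator {0..X \<omega>} x \<partial>lborel) =
        (\<integral>\<^sup>+x\<in>{0..<X \<omega>}. ennreal (2 * x) * indicator {..<c} x \<partial>lborel)"
      proof (rule nn_integral_cong_AE)
        \<comment> \<open>The fundamental theorem gives a closed interval; it differs from the
          half-open one only in the null set consisting of \<open>X \<omega>\<close>.\<close>
        show "AE x in lborel. ennreal (2 * x) * indicator {0..X \<omega>} x =
          ennreal (2 * x) * indicator {..<c} x * indicator {0..<X \<omega>} x"
          using AE_lborel_singleton[of "X \<omega>"]
          by eventually_elim (use True \<open>b \<le> c\<close> in \<open>auto simp: indicator_def\<close>)
      qed
      finally show ?thesis using True by simp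
    qed auto
  qed
  also have "\<dots> = (\<integral>\<^sup>+x\<in>{0..}. ennreal (2 * x) * indicator {..<c} x * emeasure M {\<omega>\<in>space M. x < X \<omega>} \<partial>lborel)"
    by (rule nn_integral_layer_cake) measurable
  also have "\<dots> = (\<integral>\<^sup>+x\<in>{0..<c}. ennreal (2 * x) * emeasure M {\<omega>\<in>space M. x < X \<omega>} \<partial>lborel)"
    by (intro nn_integral_cong) (auto simp: indicator_def)
  finally show ?thesis .
qed

text \<open>After centring, pairwise independence kills all off-diagonal terms of the expanded
  square. The diagonal terms are variances, each at most the raw second moment.\<close>

lemma (in prob_space) variance_sum_le_of_pairwise_indep:
  fixes Y :: "nat \<Rightarrow> 'a \<Rightarrow> real"
  assumes "finite I"
    and "\<And>i. i \<in> I \<Longrightarrow> integrable M (Y i)"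
    and "\<And>i. i \<in> I \<Longrightarrow> integrable M (\<lambda>\<omega>. (Y i \<omega>)\<^sup>2)"
    and indep: "\<And>i j. i \<in> I \<Longrightarrow> j \<in> I \<Longrightarrow> i \<noteq> j \<Longrightarrow> indep_var borel (Y i) borel (Y j)"
  shows "integrable M (\<lambda>\<omega>. ((\<Sum>i\<in>I. Y i \<omega>) - expectation (\<lambda>\<omega>. \<Sum>i\<in>I. Y i \<omega>))\<^sup>2)"
    and "variance (\<lambda>\<omega>. \<Sum>i\<in>I. Y i \<omega>) \<le> (\<Sum>i\<in>I. expectation (\<lambda>\<omega>. (Y i \<omega>)\<^sup>2))"
proof -
  define Z where "Z i \<omega> = Y i \<omega> - expectation (Y i)" for i \<omega>
  note int = assms(2,3)
  have Zi: "integrable M (Z i)" if "i \<in> I" for i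
    using that int unfolding Z_def by auto
  have Z2: "(Z i \<omega>)\<^sup>2 = (Y i \<omega>)\<^sup>2 - 2 * expectation (Y i) * Y i \<omega> + (expectation (Y i))\<^sup>2" for i \<omega>
    by (simp add: Z_def power2_eq_square algebra_simps)
  have Z2i: "integrable M (\<lambda>\<omega>. (Z i \<omega>)\<^sup>2)" if "i \<in> I" for i
    using that int unfolding Z2 by auto
  have Z0: "expectation (Z i) = 0" if "i \<in> I" for i
    using that int unfolding Z_def by (simp add: prob_space)
  have indZ: "indep_var borel (Z i) borel (Z j)" if "i \<in> I" "j \<in> I" "i \<noteq> j" for i j
    unfolding Z_def
    using indep_var_compose[OF indep[OF that], of "\<lambda>x. x - expectation (Y i)" borel "\<lambda>x. x - expectation (Y j)" borel]
    by (simp add: comp_def)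
  \<comment> \<open>Off the diagonal, independence supplies integrability of the product as well as
    its expectation.\<close>
  have Zij: "integrable M (\<lambda>\<omega>. Z i \<omega> * Z j \<omega>) \<and>
     expectation (\<lambda>\<omega>. Z i \<omega> * Z j \<omega>) = (if i = j then expectation (\<lambda>\<omega>. (Z i \<omega>)\<^sup>2) else 0)"
    if "i \<in> I" "j \<in> I" for i j
  proof (cases "i = j")
    case True
    then show ?thesis using Z2i[OF that(1)] by (simp add: power2_eq_square)
  next
    case False
    then show ?thesis
      using indep_var_integrable[OF indZ[OF that False] Zi Zi] that Z0
        indep_var_lebesgue_integral[OF indZ[OF that False] Zi Zi]
      by auto
  qed
  have *: "((\<Sum>i\<in>I. Y i \<omega>) - expectation (\<lambda>\<omega>. \<Sum>i\<in>I. Y i \<omega>))\<^sup>2 = (\<Sum>i\<in>I. \<Sum>j\<in>I. Z i \<omega> * Z j \<omega>)" for \<omega>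
  proof -
    have "(\<Sum>i\<in>I. Y i \<omega>) - expectation (\<lambda>\<omega>. \<Sum>i\<in>I. Y i \<omega>) = (\<Sum>i\<in>I. Z i \<omega>)"
      using int by (simp add: Z_def sum_subtractf)
    then show ?thesis by (simp add: power2_eq_square sum_product)
  qed
  show "integrable M (\<lambda>\<omega>. ((\<Sum>i\<in>I. Y i \<omega>) - expectation (\<lambda>\<omega>. \<Sum>i\<in>I. Y i \<omega>))\<^sup>2)"
    unfolding * using Zij by auto
  have "variance (\<lambda>\<omega>. \<Sum>i\<in>I. Y i \<omega>) = (\<Sum>i\<in>I. \<Sum>j\<in>I. expectation (\<lambda>\<omega>. Z i \<omega> * Z j \<omega>))"
    unfolding * using Zij by (subst Bochner_Integration.integral_sum; force intro!: sum.cong Bochner_Integration.integral_sum)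
  also have "\<dots> = (\<Sum>i\<in>I. \<Sum>j\<in>I. if i = j then expectation (\<lambda>\<omega>. (Z i \<omega>)\<^sup>2) else 0)"
    using Zij by (intro sum.cong refl) auto
  also have "\<dots> = (\<Sum>i\<in>I. expectation (\<lambda>\<omega>. (Z i \<omega>)\<^sup>2))"
    using \<open>finite I\<close> by (simp add: sum.delta)
  also have "\<dots> \<le> (\<Sum>i\<in>I. expectation (\<lambda>\<omega>. (Y i \<omega>)\<^sup>2))"
  proof (rule sum_mono)
    fix i assume "i \<in> I"
    then have "expectation (\<lambda>\<omega>. (Z i \<omega>)\<^sup>2) = expectation (\<lambda>\<omega>. (Y i \<omega>)\<^sup>2) - (expectation (Y i))\<^sup>2"
      unfolding Z_def using int by (intro variance_eq) auto
    then show "expectation (\<lambda>\<omega>. (Z i \<omega>)\<^sup>2) \<le> expectation (\<lambda>\<omega>. (Y i \<omega>)\<^sup>2)" by simp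
  qed
  finally show "variance (\<lambda>\<omega>. \<Sum>i\<in>I. Y i \<omega>) \<le> (\<Sum>i\<in>I. expectation (\<lambda>\<omega>. (Y i \<omega>)\<^sup>2))" .
qed

section \<open>Dyadic blocks\<close>

lemma ex_dyadic_bracket:
  fixes x :: real
  assumes "1 \<le> x"
  obtains m :: nat where "2 ^ m \<le> x" "x < 2 ^ Suc m"
proof -
  define m where "m = (LEAST m. x < 2 ^ Suc m)"
  obtain k where "x < 2 ^ k" using real_arch_pow[of 2 x] by auto
  then have "x < 2 ^ Suc k" by (rule less_trans) simp
  then have "x < 2 ^ Suc m" unfolding m_def by (rule LeastI)
  moreover have "2 ^ m \<le> x"
  proof (cases m)
    case (Suc j)
    then have "\<not> x < 2 ^ Suc j" unfolding m_def by (intro not_less_Least) simp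
    then show ?thesis using Suc by simp
  qed (use assms in auto)
  ultimately show ?thesis using that by blast
qed

text \<open>The constant \<open>16\<close>: the first nonzero term is at most \<open>8\<close>, and the terms are then geometric with ratio \<open>1/2\<close>.\<close>
lemma suminf_dyadic_tail_le:
  fixes x :: real
  assumes "x \<ge> 0"
  shows "(\<Sum>m. ennreal (if x < 2 ^ Suc m then 4 * x / 2 ^ m else 0)) \<le> 16"
proof (rule suminf_le_const)
  fix N
  let ?f = "\<lambda>m. if x < 2 ^ Suc m then 4 * x / 2 ^ m else 0"
  \<comment> \<open>Carrying the remaining geometric tail \<open>8x/2^N\<close> makes the bound inductive.\<close>
  have "(\<Sum>m<N. ?f m) \<le> (if x < 2 ^ N then 16 - 8 * x / 2 ^ N else 0)"
  proof (induction N)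
    case (Suc N)
    have "x < 2 ^ N \<Longrightarrow> x < 2 ^ Suc N" using assms by simp
    moreover have "4 * x / 2 ^ N \<le> 16 - 4 * x / 2 ^ N" if "x < 2 ^ Suc N"
      using that by (simp add: field_simps)
    moreover have "8 * x / 2 ^ N = 2 * (4 * x / 2 ^ N)" "8 * x / 2 ^ Suc N = 4 * x / 2 ^ N"
      by (simp_all add: field_simps)
    ultimately show ?case using Suc.IH
      unfolding sum.lessThan_Suc by argo
  qed (use assms in auto)
  also have "\<dots> \<le> 16" using assms by auto
  finally have "ennreal (\<Sum>m<N. ?f m) \<le> ennreal 16" by (rule ennreal_leI)
  then show "(\<Sum>m<N. ennreal (?f m)) \<le> 16"
    using assms by (subst sum_ennreal) auto
qed auto

lemma unbounded_mono_on_eventually_ge: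
  fixes a :: "nat \<Rightarrow> real"
  assumes "mono_on {1..} a" "\<not> bdd_above (a ` {1..})"
  shows "\<forall>\<^sub>F n in sequentially. c \<le> a n"
proof -
  obtain N where N: "N \<ge> 1" "c < a N"
  proof -
    have "\<exists>x\<in>a ` {1..}. \<not> x \<le> c" using assms(2) unfolding bdd_above_def by blast
    then show ?thesis using that by (metis atLeast_iff imageE not_le)
  qed
  have "c \<le> a n" if "n \<ge> N" for n
    using mono_onD[OF assms(1), of N n] N that by simp
  then show ?thesis by (auto simp: eventually_sequentially)
qed

text \<open>\<open>E m\<close> consists of the least and greatest elements of the pieces into which the block
  \<open>2^m \<le> a n < 2^(m+1)\<close> is cut according to the integer part of \<open>\<mu> n / (\<epsilon> 2^m)\<close>.\<close>
lemma finite_block_endpoints: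
  fixes a \<mu> :: "nat \<Rightarrow> real"
  assumes a: "mono_on {1..} a" "\<not> bdd_above (a ` {1..})"
    and \<mu>: "\<And>n. n \<ge> 1 \<Longrightarrow> 0 \<le> \<mu> n" "\<And>n. n \<ge> 1 \<Longrightarrow> \<mu> n \<le> a n * U"
    and "\<epsilon> > 0"
  obtains E :: "nat \<Rightarrow> nat set" and C :: nat where
    "\<And>m. finite (E m)" "\<And>m. card (E m) \<le> C" "\<And>m e. e \<in> E m \<Longrightarrow> e \<ge> 1 \<and> a e < 2 ^ Suc m"
    "\<And>m n. n \<ge> 1 \<Longrightarrow> 2 ^ m \<le> a n \<Longrightarrow> a n < 2 ^ Suc m \<Longrightarrow>
      \<exists>l\<in>E m. \<exists>h\<in>E m. l \<le> n \<and> n \<le> h \<and> \<mu> h \<le> \<mu> n + \<epsilon> * 2 ^ m \<and> \<mu> n \<le> \<mu> l + \<epsilon> * 2 ^ m"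
proof -
  define slot where "slot m n = nat \<lfloor>\<mu> n / (\<epsilon> * 2 ^ m)\<rfloor>" for m n :: nat
  define B where "B m s = {n. n \<ge> 1 \<and> a n < 2 ^ Suc m \<and> 2 ^ m \<le> a n \<and> slot m n = s}" for m s :: nat
  \<comment> \<open>In block \<open>m\<close> the bound
    \<open>\<mu> n \<le> 2 ^ Suc m * \<bar>U\<bar>\<close> gives \<open>\<mu> n / (\<epsilon> * 2 ^
    m) \<le> 2 * \<bar>U\<bar> / \<epsilon>\<close>, so \<open>L\<close> exceeds every slot number,
    whatever \<open>m\<close> is. The absolute value is there because the sign of \<open>U\<close>
    is not assumed.\<close>
  define L where "L = nat \<lceil>2 * \<bar>U\<bar> / \<epsilon>\<rceil> + 1"
  \<comment> \<open>Unboundedness of \<open>a\<close> makes every piece finite, so that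
    \<open>Min\<close> and \<open>Max\<close> are attained.\<close>
  have finB: "finite (B m s)" for m s
  proof -
    obtain N where N: "\<And>n. n \<ge> N \<Longrightarrow> 2 ^ Suc m \<le> a n"
      using unbounded_mono_on_eventually_ge[OF a, of "2 ^ Suc m"] unfolding eventually_sequentially by blast
    have "n < N" if "n \<in> B m s" for n
      using N[of n] that by (force simp: B_def simp del: power_Suc)
    then have "B m s \<subseteq> {..<N}" by auto
    then show ?thesis by (rule finite_subset) simp
  qed
  \<comment> \<open>Empty pieces are left out, as their \<open>Min\<close> and \<open>Max\<close>
    would be unspecified.\<close>
  define J where "J m = {s. s < L \<and> B m s \<noteq> {}}" for m
  define E where "E m = (\<lambda>s. Min (B m s)) ` J m \<union> (\<lambda>s. Max (B m s)) ` J m" for m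
  have J: "finite (J m)" "card (J m) \<le> L" for m
  proof -
    show "finite (J m)" by (auto simp: J_def)
    have "card (J m) \<le> card {..<L}" by (intro card_mono) (auto simp: J_def)
    then show "card (J m) \<le> L" by simp
  qed
  show ?thesis
  proof (rule that[of E "2 * L"])
    show "finite (E m)" for m using J by (auto simp: E_def)
    show "card (E m) \<le> 2 * L" for m
    proof -
      have "card (E m) \<le> card ((\<lambda>s. Min (B m s)) ` J m) + card ((\<lambda>s. Max (B m s)) ` J m)"
        unfolding E_def by (rule card_Un_le)
      also have "\<dots> \<le> card (J m) + card (J m)"
        by (intro add_mono card_image_le J)
      finally show ?thesis using J[of m] by simp
    qed
    show "e \<ge> 1 \<and> a e < 2 ^ Suc m" if "e \<in> E m" for m e
    proof -
      have "\<exists>s. e \<in> B m s"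
        using that Min_in[OF finB] Max_in[OF finB] unfolding E_def J_def by blast
      then show ?thesis by (auto simp: B_def)
    qed
    fix m n :: nat
    assume n: "n \<ge> 1" "2 ^ m \<le> a n" "a n < 2 ^ Suc m"
    define s where "s = slot m n"
    have pos: "\<epsilon> * 2 ^ m > 0" using \<open>\<epsilon> > 0\<close> by simp
    have nB: "n \<in> B m s" using n by (auto simp: B_def s_def)
    have "\<mu> n / (\<epsilon> * 2 ^ m) \<le> 2 * \<bar>U\<bar> / \<epsilon>"
    proof -
      have "\<mu> n \<le> a n * \<bar>U\<bar>"
        using \<mu>(2)[OF n(1)] order_trans[OF zero_le_power n(2)] mult_left_mono[OF abs_ge_self, of "a n" U]
        by simp
      also have "\<dots> \<le> 2 ^ Suc m * \<bar>U\<bar>" using n(3) by (intro mult_right_mono) auto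
      finally show ?thesis using \<open>\<epsilon> > 0\<close> by (simp add: field_simps)
    qed
    then have "s < L" unfolding s_def slot_def L_def by linarith
    then have sJ: "s \<in> J m" using nB by (auto simp: J_def)
    \<comment> \<open>Values with equal integer parts differ by at most 1, and \<open>nat\<close>
      loses nothing since \<open>\<mu>\<close> is non-negative. As \<open>\<mu>\<close> is not
      assumed monotone, a piece may have gaps; only closeness of \<open>\<mu>\<close> on the piece
      and the position of its extremes matter.\<close>
    have near: "\<mu> i \<le> \<mu> j + \<epsilon> * 2 ^ m" if "i \<in> B m s" "j \<in> B m s" for i j
    proof -
      have "0 \<le> \<mu> i / (\<epsilon> * 2 ^ m)" "0 \<le> \<mu> j / (\<epsilon> * 2 ^ m)"
        using that \<mu>(1)[of i] \<mu>(1)[of j] pos by (auto simp: B_def intro!: divide_nonneg_pos)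
      moreover have "nat \<lfloor>\<mu> i / (\<epsilon> * 2 ^ m)\<rfloor> = nat \<lfloor>\<mu> j / (\<epsilon> * 2 ^ m)\<rfloor>"
        using that unfolding B_def slot_def by simp
      ultimately have "\<lfloor>\<mu> i / (\<epsilon> * 2 ^ m)\<rfloor> = \<lfloor>\<mu> j / (\<epsilon> * 2 ^ m)\<rfloor>"
        by (simp add: eq_nat_nat_iff)
      then have "\<mu> i / (\<epsilon> * 2 ^ m) \<le> \<mu> j / (\<epsilon> * 2 ^ m) + 1" by linarith
      then show ?thesis using \<open>\<epsilon> > 0\<close> by (simp add: field_simps)
    qed
    have ne: "B m s \<noteq> {}" using nB by auto
    show "\<exists>l\<in>E m. \<exists>h\<in>E m. l \<le> n \<and> n \<le> h \<and> \<mu> h \<le> \<mu> n + \<epsilon> * 2 ^ m \<and> \<mu> n \<le> \<mu> l + \<epsilon> * 2 ^ m"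
    proof (rule bexI[of _ "Min (B m s)"], rule bexI[of _ "Max (B m s)"], intro conjI)
      show "Min (B m s) \<in> E m" "Max (B m s) \<in> E m" using sJ unfolding E_def by blast+
      show "Min (B m s) \<le> n" "n \<le> Max (B m s)" using finB nB by simp_all
      show "\<mu> (Max (B m s)) \<le> \<mu> n + \<epsilon> * 2 ^ m" using near Max_in[OF finB ne] nB by blast
      show "\<mu> n \<le> \<mu> (Min (B m s)) + \<epsilon> * 2 ^ m" using near Min_in[OF finB ne] nB by blast
    qed
  qed
qed

section \<open>Non-negative variables\<close>

text \<open>The setting shared by the positive and the negative parts. Only an upper bound
  \<open>g\<close> for the averaged tails is required, so the same function, built from the absolute
  values, serves both. The bound is multiplied through by \<open>a n\<close> to avoid division in
  \<open>ennreal\<close>.\<close>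

locale nonneg_tail_dominated = prob_space M for M :: "'a measure" +
  fixes X :: "nat \<Rightarrow> 'a \<Rightarrow> real" and a :: "nat \<Rightarrow> real" and g :: "real \<Rightarrow> ennreal"
  assumes X_meas [measurable]: "\<And>n. X n \<in> borel_measurable M"
    and X_nonneg: "\<And>n \<omega>. 0 \<le> X n \<omega>"
    and indep: "\<And>i j. i \<ge> 1 \<Longrightarrow> j \<ge> 1 \<Longrightarrow> i \<noteq> j \<Longrightarrow> indep_var borel (X i) borel (X j)"
    and a_mono: "mono_on {1..} a"
    and a_unbdd: "\<not> bdd_above (a ` {1..})"
    and a_pos: "\<And>n. n \<ge> 1 \<Longrightarrow> a n > 0"
    and g_meas [measurable]: "g \<in> borel_measurable borel"
    and tail_le: "\<And>n x. n \<ge> 1 \<Longrightarrow> x \<ge> 0 \<Longrightarrow>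
      (\<Sum>k=1..n. emeasure M {\<omega>\<in>space M. x < X k \<omega>}) \<le> ennreal (a n) * g x"
    and g_fin: "(\<integral>\<^sup>+x\<in>{0..}. g x \<partial>lborel) < \<infinity>"
    and exceed: "summable (\<lambda>n. prob {\<omega>\<in>space M. a (Suc n) < X (Suc n) \<omega>})"
begin

section \<open>Means controlled by the integral of \<open>g\<close>\<close>

definition U where "U = enn2real (\<integral>\<^sup>+x\<in>{0..}. g x \<partial>lborel)"

lemma U: "(\<integral>\<^sup>+x\<in>{0..}. g x \<partial>lborel) = ennreal U" "U \<ge> 0"
  using g_fin by (auto simp: U_def)

text \<open>Layer-cake formula for each summand, then \<open>tail_le\<close> under the integral
  sign.\<close>

lemma sum_excess_le:
  assumes "n \<ge> 1" "c \<ge> 0"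
  shows "(\<Sum>k=1..n. \<integral>\<^sup>+\<omega>. ennreal (X k \<omega> - c) \<partial>M) \<le> ennreal (a n) * (\<integral>\<^sup>+x\<in>{c..}. g x \<partial>lborel)"
proof -
  have "(\<Sum>k=1..n. \<integral>\<^sup>+\<omega>. ennreal (X k \<omega> - c) \<partial>M) =
      (\<Sum>k=1..n. \<integral>\<^sup>+x\<in>{c..}. emeasure M {\<omega>\<in>space M. x < X k \<omega>} \<partial>lborel)"
    using assms by (intro sum.cong refl nn_integral_excess_eq_tail) auto
  also have "\<dots> = (\<integral>\<^sup>+x. (\<Sum>k=1..n. emeasure M {\<omega>\<in>space M. x < X k \<omega>} * indicator {c..} x) \<partial>lborel)"
    by (rule nn_integral_sum[symmetric]) measurable
  also have "\<dots> \<le> (\<integral>\<^sup>+x. ennreal (a n) * (g x * indicator {c..} x) \<partial>lborel)"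
    using assms tail_le[of n] by (intro nn_integral_mono) (auto simp: indicator_def)
  also have "\<dots> = ennreal (a n) * (\<integral>\<^sup>+x\<in>{c..}. g x \<partial>lborel)"
    by (rule nn_integral_cmult) measurable
  finally show ?thesis .
qed

text \<open>Integrability is a consequence of the finite integral of \<open>g\<close>: a single mean
  is at most the whole sum of means, to which \<open>sum_excess_le\<close> applies with
  \<open>c = 0\<close>.\<close>

lemma integrable_X:
  assumes "k \<ge> 1"
  shows "integrable M (X k)"
proof (rule integrableI_nonneg)
  have "(\<integral>\<^sup>+\<omega>. ennreal (X k \<omega>) \<partial>M) \<le> (\<Sum>i=1..k. \<integral>\<^sup>+\<omega>. ennreal (X i \<omega> - 0) \<partial>M)"
    using assms member_le_sum[of k "{1..k}" "\<lambda>i. \<integral>\<^sup>+\<omega>. ennreal (X i \<omega>) \<partial>M"] by simp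
  also have "\<dots> \<le> ennreal (a k) * ennreal U"
    using sum_excess_le[of k 0] assms U by simp
  also have "\<dots> < \<infinity>" by (simp add: ennreal_mult_less_top)
  finally show "(\<integral>\<^sup>+\<omega>. ennreal (X k \<omega>) \<partial>M) < \<infinity>" .
qed (use X_nonneg in auto)

lemma sum_expectation_le:
  assumes "n \<ge> 1"
  shows "(\<Sum>k=1..n. expectation (X k)) \<le> a n * U"
proof -
  have "ennreal (\<Sum>k=1..n. expectation (X k)) = (\<Sum>k=1..n. \<integral>\<^sup>+\<omega>. ennreal (X k \<omega> - 0) \<partial>M)"
    using sum_nn_integral_eq_integral[of "{1..n}" M X] integrable_X X_nonneg by simp
  also have "\<dots> \<le> ennreal (a n * U)"
    using sum_excess_le[of n 0] assms U a_pos[of n] by (simp add: ennreal_mult)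
  finally show ?thesis using U a_pos[of n] assms by (simp add: ennreal_le_iff)
qed

section \<open>Truncation and second moments\<close>

definition Y where "Y k \<omega> = (if X k \<omega> \<le> a k then X k \<omega> else 0)"
definition T where "T n \<omega> = (\<Sum>k=1..n. Y k \<omega>)"

lemma Y_meas [measurable]: "Y k \<in> borel_measurable M"
  unfolding Y_def by measurable

lemma T_meas [measurable]: "T n \<in> borel_measurable M"
  unfolding T_def by measurable

text \<open>The absolute value covers index 0, where \<open>a\<close> need not be positive.\<close>

lemma Y_bounds: "0 \<le> Y k \<omega>" "Y k \<omega> \<le> X k \<omega>" "Y k \<omega> \<le> \<bar>a k\<bar>"
  using X_nonneg by (auto simp: Y_def)

lemma integrable_Y: "integrable M (Y k)" "integrable M (\<lambda>\<omega>. (Y k \<omega>)\<^sup>2)"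
proof -
  show "integrable M (Y k)"
    using Y_bounds by (intro integrable_const_bound[of _ "\<bar>a k\<bar>"]) auto
  have "(Y k \<omega>)\<^sup>2 \<le> \<bar>a k\<bar>\<^sup>2" for \<omega>
    using Y_bounds by (intro power_mono) auto
  then show "integrable M (\<lambda>\<omega>. (Y k \<omega>)\<^sup>2)"
    by (intro integrable_const_bound[of _ "\<bar>a k\<bar>\<^sup>2"]) auto
qed

text \<open>The level \<open>a k\<close> depends on the summand and not on \<open>n\<close>, so
  passing to a larger \<open>n\<close> only adds non-negative terms. This is what lets the end
  points of a piece control its interior.\<close>

lemma T_mono: "m \<le> n \<Longrightarrow> T m \<omega> \<le> T n \<omega>"
  unfolding T_def using Y_bounds by (intro sum_mono2) auto

lemma expectation_T: "expectation (T n) = (\<Sum>k=1..n. expectation (Y k))"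
  unfolding T_def using integrable_Y by (intro Bochner_Integration.integral_sum) auto

lemma expectation_T_bounds:
  assumes "n \<ge> 1"
  shows "0 \<le> expectation (T n)" "expectation (T n) \<le> a n * U"
proof -
  show "0 \<le> expectation (T n)"
    unfolding T_def using Y_bounds by (intro integral_nonneg_AE) (auto intro!: sum_nonneg)
  have "expectation (T n) \<le> (\<Sum>k=1..n. expectation (X k))"
    unfolding expectation_T using Y_bounds integrable_Y integrable_X by (intro sum_mono integral_mono) auto
  also have "\<dots> \<le> a n * U" by (rule sum_expectation_le[OF assms])
  finally show "expectation (T n) \<le> a n * U" .
qed

lemma indep_Y:
  assumes "i \<ge> 1" "j \<ge> 1" "i \<noteq> j"
  shows "indep_var borel (Y i) borel (Y j)"
  using indep_var_compose[OF indep[OF assms], of "\<lambda>x. if x \<le> a i then x else 0" borel "\<lambda>x. if x \<le> a j then x else 0" borel]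
  by (simp add: comp_def Y_def[abs_def])

text \<open>All levels satisfy \<open>a k \<le> a n \<le> c\<close>, so \<open>c\<close> is a common
  cut-off. The factor \<open>2 * x\<close> comes from the square, the factor \<open>c\<close> from
  \<open>tail_le\<close> with \<open>a n \<le> c\<close>.\<close>

lemma sum_second_moment_le:
  assumes "n \<ge> 1" "a n \<le> c"
  shows "ennreal (\<Sum>k=1..n. expectation (\<lambda>\<omega>. (Y k \<omega>)\<^sup>2)) \<le>
    (\<integral>\<^sup>+x\<in>{0..<c}. ennreal (2 * x * c) * g x \<partial>lborel)"
proof -
  have c: "c > 0" using a_pos assms by force
  have "ennreal (\<Sum>k=1..n. expectation (\<lambda>\<omega>. (Y k \<omega>)\<^sup>2)) = (\<Sum>k=1..n. \<integral>\<^sup>+\<omega>. ennreal ((Y k \<omega>)\<^sup>2) \<partial>M)"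
    using sum_nn_integral_eq_integral[of "{1..n}" M "\<lambda>k \<omega>. (Y k \<omega>)\<^sup>2"] integrable_Y by simp
  also have "\<dots> \<le> (\<Sum>k=1..n. \<integral>\<^sup>+x\<in>{0..<c}. ennreal (2 * x) * emeasure M {\<omega>\<in>space M. x < X k \<omega>} \<partial>lborel)"
  proof (rule sum_mono)
    fix k assume k: "k \<in> {1..n}"
    then have "a k \<le> a n" by (intro mono_onD[OF a_mono]) auto
    then show "(\<integral>\<^sup>+\<omega>. ennreal ((Y k \<omega>)\<^sup>2) \<partial>M) \<le>
      (\<integral>\<^sup>+x\<in>{0..<c}. ennreal (2 * x) * emeasure M {\<omega>\<in>space M. x < X k \<omega>} \<partial>lborel)"
      unfolding Y_def using X_nonneg assms by (intro nn_integral_truncated_square_le_tail) auto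
  qed
  also have "\<dots> = (\<integral>\<^sup>+x. (\<Sum>k=1..n. ennreal (2 * x) * emeasure M {\<omega>\<in>space M. x < X k \<omega>} * indicator {0..<c} x) \<partial>lborel)"
    by (rule nn_integral_sum[symmetric]) measurable
  also have "\<dots> \<le> (\<integral>\<^sup>+x\<in>{0..<c}. ennreal (2 * x * c) * g x \<partial>lborel)"
  proof (rule nn_integral_mono)
    fix x :: real
    show "(\<Sum>k=1..n. ennreal (2 * x) * emeasure M {\<omega>\<in>space M. x < X k \<omega>} * indicator {0..<c} x) \<le>
      ennreal (2 * x * c) * g x * indicator {0..<c} x"
    proof (cases "x \<in> {0..<c}")
      case True
      have "(\<Sum>k=1..n. emeasure M {\<omega>\<in>space M. x < X k \<omega>}) \<le> ennreal (a n) * g x"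
        using True assms by (intro tail_le) auto
      also have "\<dots> \<le> ennreal c * g x"
        using assms by (intro mult_right_mono ennreal_leI) auto
      finally have "ennreal (2 * x) * (\<Sum>k=1..n. emeasure M {\<omega>\<in>space M. x < X k \<omega>}) \<le> ennreal (2 * x) * (ennreal c * g x)"
        by (rule mult_left_mono) auto
      then show ?thesis using True c by (simp add: sum_distrib_left ennreal_mult mult.assoc)
    qed auto
  qed
  finally show ?thesis .
qed

section \<open>Almost sure convergence of the truncated sums\<close>

lemma deviation_nn_integral_le:
  assumes "n \<ge> 1" "a n \<le> c"
  shows "(\<integral>\<^sup>+\<omega>. ennreal ((T n \<omega> - expectation (T n))\<^sup>2) \<partial>M) \<le>
    (\<integral>\<^sup>+x\<in>{0..<c}. ennreal (2 * x * c) * g x \<partial>lborel)"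
proof -
  have T: "T n = (\<lambda>\<omega>. \<Sum>k=1..n. Y k \<omega>)" by (auto simp: T_def)
  have var: "integrable M (\<lambda>\<omega>. (T n \<omega> - expectation (T n))\<^sup>2)"
    "variance (T n) \<le> (\<Sum>k=1..n. expectation (\<lambda>\<omega>. (Y k \<omega>)\<^sup>2))"
    unfolding T by (intro variance_sum_le_of_pairwise_indep integrable_Y indep_Y; simp)+
  have "(\<integral>\<^sup>+\<omega>. ennreal ((T n \<omega> - expectation (T n))\<^sup>2) \<partial>M) = ennreal (variance (T n))"
    using var(1) by (intro nn_integral_eq_integral) auto
  also have "\<dots> \<le> ennreal (\<Sum>k=1..n. expectation (\<lambda>\<omega>. (Y k \<omega>)\<^sup>2))"
    using var(2) by (rule ennreal_leI)
  also have "\<dots> \<le> (\<integral>\<^sup>+x\<in>{0..<c}. ennreal (2 * x * c) * g x \<partial>lborel)"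
    by (rule sum_second_moment_le[OF assms])
  finally show ?thesis .
qed

text \<open>The expectations of the normalised block deviations sum to at most
  \<open>16 * C * U\<close>: exchanging sum and integral leaves the kernel sum bounded by
  \<open>suminf_dyadic_tail_le\<close> at each \<open>x\<close>. A non-negative series with finite
  expectation converges almost surely, so its terms tend to 0.\<close>

lemma AE_block_deviation_tendsto_0:
  fixes E :: "nat \<Rightarrow> nat set" and C :: nat
  assumes fin: "\<And>m. finite (E m)" and card: "\<And>m. card (E m) \<le> C"
    and E: "\<And>m e. e \<in> E m \<Longrightarrow> e \<ge> 1 \<and> a e < 2 ^ Suc m"
  shows "AE \<omega> in M. (\<lambda>m. (\<Sum>e\<in>E m. (T e \<omega> - expectation (T e))\<^sup>2) / 4 ^ m) \<longlonglongrightarrow> 0"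
proof -
  define D where "D m \<omega> = (\<Sum>e\<in>E m. (T e \<omega> - expectation (T e))\<^sup>2) / 4 ^ m" for m \<omega>
  have [measurable]: "D m \<in> borel_measurable M" for m unfolding D_def by measurable
  \<comment> \<open>This is the kernel \<open>2 * x * c / 4 ^ m\<close> of the variance bound at
    \<open>c = 2 ^ Suc m\<close>, restricted to \<open>x < c\<close>.\<close>
  define k where "k m x = (if x < 2 ^ Suc m then 4 * x / 2 ^ m else 0)" for m :: nat and x :: real
  have [measurable]: "k m \<in> borel_measurable borel" for m unfolding k_def by measurable
  have D_le: "(\<integral>\<^sup>+\<omega>. ennreal (D m \<omega>) \<partial>M) \<le> of_nat C * (\<integral>\<^sup>+x\<in>{0..}. ennreal (k m x) * g x \<partial>lborel)" for m
  proof -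
    have "(\<integral>\<^sup>+\<omega>. ennreal (D m \<omega>) \<partial>M) =
      (\<integral>\<^sup>+\<omega>. (\<Sum>e\<in>E m. ennreal (1 / 4 ^ m) * ennreal ((T e \<omega> - expectation (T e))\<^sup>2)) \<partial>M)"
    proof (rule nn_integral_cong)
      fix \<omega>
      have "D m \<omega> = (\<Sum>e\<in>E m. 1 / 4 ^ m * (T e \<omega> - expectation (T e))\<^sup>2)"
        unfolding D_def by (simp add: sum_divide_distrib)
      then show "ennreal (D m \<omega>) = (\<Sum>e\<in>E m. ennreal (1 / 4 ^ m) * ennreal ((T e \<omega> - expectation (T e))\<^sup>2))"
        by (simp add: sum_ennreal ennreal_mult'[symmetric])
    qed
    also have "\<dots> = (\<Sum>e\<in>E m. \<integral>\<^sup>+\<omega>. ennreal (1 / 4 ^ m) * ennreal ((T e \<omega> - expectation (T e))\<^sup>2) \<partial>M)"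
      by (rule nn_integral_sum) measurable
    also have "\<dots> \<le> (\<Sum>e\<in>E m. \<integral>\<^sup>+x\<in>{0..}. ennreal (k m x) * g x \<partial>lborel)"
    proof (rule sum_mono)
      fix e assume e: "e \<in> E m"
      have "(\<integral>\<^sup>+\<omega>. ennreal (1 / 4 ^ m) * ennreal ((T e \<omega> - expectation (T e))\<^sup>2) \<partial>M) =
        ennreal (1 / 4 ^ m) * (\<integral>\<^sup>+\<omega>. ennreal ((T e \<omega> - expectation (T e))\<^sup>2) \<partial>M)"
        by (rule nn_integral_cmult) measurable
      also have "\<dots> \<le> ennreal (1 / 4 ^ m) * (\<integral>\<^sup>+x\<in>{0..<2 ^ Suc m}. ennreal (2 * x * 2 ^ Suc m) * g x \<partial>lborel)"
        using E[OF e] by (intro mult_left_mono deviation_nn_integral_le) auto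
      also have "\<dots> = (\<integral>\<^sup>+x. ennreal (1 / 4 ^ m) * (ennreal (2 * x * 2 ^ Suc m) * g x * indicator {0..<2 ^ Suc m} x) \<partial>lborel)"
        by (rule nn_integral_cmult[symmetric]) measurable
      also have "\<dots> = (\<integral>\<^sup>+x\<in>{0..}. ennreal (k m x) * g x \<partial>lborel)"
      proof (rule nn_integral_cong)
        fix x :: real
        have "(4::real) ^ m = 2 ^ m * 2 ^ m" by (simp flip: power_mult_distrib)
        then have "1 / 4 ^ m * (2 * x * 2 ^ Suc m) = 4 * x / 2 ^ m" by (simp add: field_simps)
        then show "ennreal (1 / 4 ^ m) * (ennreal (2 * x * 2 ^ Suc m) * g x * indicator {0..<2 ^ Suc m} x) =
          ennreal (k m x) * g x * indicator {0..} x"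
          by (auto simp: k_def indicator_def mult.assoc[symmetric] ennreal_mult'[symmetric] simp del: power_Suc)
      qed
      finally show "(\<integral>\<^sup>+\<omega>. ennreal (1 / 4 ^ m) * ennreal ((T e \<omega> - expectation (T e))\<^sup>2) \<partial>M) \<le>
        (\<integral>\<^sup>+x\<in>{0..}. ennreal (k m x) * g x \<partial>lborel)" .
    qed
    also have "\<dots> \<le> of_nat C * (\<integral>\<^sup>+x\<in>{0..}. ennreal (k m x) * g x \<partial>lborel)"
      using card[of m] by (auto intro!: mult_right_mono)
    finally show ?thesis .
  qed
  have "(\<integral>\<^sup>+\<omega>. (\<Sum>m. ennreal (D m \<omega>)) \<partial>M) = (\<Sum>m. \<integral>\<^sup>+\<omega>. ennreal (D m \<omega>) \<partial>M)"
    by (rule nn_integral_suminf) measurable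
  also have "\<dots> \<le> (\<Sum>m. of_nat C * (\<integral>\<^sup>+x\<in>{0..}. ennreal (k m x) * g x \<partial>lborel))"
    by (intro suminf_le D_le) auto
  also have "\<dots> = of_nat C * (\<Sum>m. (\<integral>\<^sup>+x\<in>{0..}. ennreal (k m x) * g x \<partial>lborel))"
    by simp
  also have "(\<Sum>m. (\<integral>\<^sup>+x\<in>{0..}. ennreal (k m x) * g x \<partial>lborel)) =
      (\<integral>\<^sup>+x. (\<Sum>m. ennreal (k m x) * g x * indicator {0..} x) \<partial>lborel)"
    by (rule nn_integral_suminf[symmetric]) measurable
  also have "\<dots> \<le> (\<integral>\<^sup>+x. 16 * (g x * indicator {0..} x) \<partial>lborel)"
  proof (rule nn_integral_mono)
    fix x :: real
    show "(\<Sum>m. ennreal (k m x) * g x * indicator {0..} x) \<le> 16 * (g x * indicator {0..} x)"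
    proof (cases "x \<ge> 0")
      case True
      have "(\<Sum>m. ennreal (k m x)) * g x \<le> 16 * g x"
        unfolding k_def by (intro mult_right_mono suminf_dyadic_tail_le[OF True]) auto
      then show ?thesis using True by simp
    qed auto
  qed
  also have "\<dots> = 16 * ennreal U"
    using U by (simp add: nn_integral_cmult)
  finally have "(\<integral>\<^sup>+\<omega>. (\<Sum>m. ennreal (D m \<omega>)) \<partial>M) \<le> of_nat C * (16 * ennreal U)"
    by (auto simp: mult_left_mono)
  also have "\<dots> < \<infinity>"
    by (simp add: ennreal_mult_less_top of_nat_less_top)
  finally have "AE \<omega> in M. (\<Sum>m. ennreal (D m \<omega>)) \<noteq> \<infinity>"
    by (intro nn_integral_PInf_AE) auto
  then show ?thesis
  proof eventually_elim
    fix \<omega> assume "(\<Sum>m. ennreal (D m \<omega>)) \<noteq> \<infinity>"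
    then have "summable (\<lambda>m. D m \<omega>)"
      by (intro summable_suminf_not_top) (auto simp: D_def intro!: divide_nonneg_nonneg sum_nonneg)
    then show "(\<lambda>m. (\<Sum>e\<in>E m. (T e \<omega> - expectation (T e))\<^sup>2) / 4 ^ m) \<longlonglongrightarrow> 0"
      unfolding D_def by (rule summable_LIMSEQ_zero)
  qed
qed

text \<open>One \<open>\<epsilon>\<close> pays for the random deviation at an end point, the other
  for the variation of the mean inside the piece.\<close>

lemma AE_eventually_truncated_le:
  assumes "\<epsilon> > 0"
  shows "AE \<omega> in M. \<forall>\<^sub>F n in sequentially. \<bar>T n \<omega> - expectation (T n)\<bar> \<le> 2 * \<epsilon> * a n"
proof -
  define \<mu> where "\<mu> n = expectation (T n)" for n
  have \<mu>: "\<And>n. n \<ge> 1 \<Longrightarrow> 0 \<le> \<mu> n" "\<And>n. n \<ge> 1 \<Longrightarrow> \<mu> n \<le> a n * U"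
    unfolding \<mu>_def by (fact expectation_T_bounds)+
  obtain E C where EC: "\<And>m. finite (E m)" "\<And>m. card (E m) \<le> C" "\<And>m e. e \<in> E m \<Longrightarrow> e \<ge> 1 \<and> a e < 2 ^ Suc m"
    and bracket: "\<And>m n. n \<ge> 1 \<Longrightarrow> 2 ^ m \<le> a n \<Longrightarrow> a n < 2 ^ Suc m \<Longrightarrow>
      \<exists>l\<in>E m. \<exists>h\<in>E m. l \<le> n \<and> n \<le> h \<and> \<mu> h \<le> \<mu> n + \<epsilon> * 2 ^ m \<and> \<mu> n \<le> \<mu> l + \<epsilon> * 2 ^ m"
    by (rule finite_block_endpoints[OF a_mono a_unbdd \<mu> assms]) (assumption+, rule that)
  have "AE \<omega> in M. (\<lambda>m. (\<Sum>e\<in>E m. (T e \<omega> - expectation (T e))\<^sup>2) / 4 ^ m) \<longlonglongrightarrow> 0"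
    by (rule AE_block_deviation_tendsto_0[of E C]) (fact EC)+
  then show ?thesis
  proof eventually_elim
    fix \<omega>
    assume "(\<lambda>m. (\<Sum>e\<in>E m. (T e \<omega> - expectation (T e))\<^sup>2) / 4 ^ m) \<longlonglongrightarrow> 0"
    then have "\<forall>\<^sub>F m in sequentially. (\<Sum>e\<in>E m. (T e \<omega> - expectation (T e))\<^sup>2) / 4 ^ m < \<epsilon>\<^sup>2"
      using assms by (intro order_tendstoD) auto
    then obtain m0 where m0: "\<And>m. m \<ge> m0 \<Longrightarrow> (\<Sum>e\<in>E m. (T e \<omega> - \<mu> e)\<^sup>2) / 4 ^ m < \<epsilon>\<^sup>2"
      by (auto simp: eventually_sequentially \<mu>_def)
    \<comment> \<open>Each square is at most the sum over \<open>E m\<close>, and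
      \<open>4 ^ m\<close> is the square of \<open>2 ^ m\<close>.\<close>
    have end_le: "\<bar>T e \<omega> - \<mu> e\<bar> \<le> \<epsilon> * 2 ^ m" if "m \<ge> m0" "e \<in> E m" for m e
    proof -
      have "(T e \<omega> - \<mu> e)\<^sup>2 \<le> (\<Sum>e\<in>E m. (T e \<omega> - \<mu> e)\<^sup>2)"
        using that EC(1) by (intro member_le_sum) auto
      also have "\<dots> \<le> \<epsilon>\<^sup>2 * 4 ^ m"
        using m0[OF that(1)] by (simp add: field_simps)
      also have "\<dots> = (\<epsilon> * 2 ^ m)\<^sup>2"
        using power_mult_distrib[of "2::real" 2 m] by (simp add: power2_eq_square)
      finally have "\<bar>T e \<omega> - \<mu> e\<bar> \<le> \<bar>\<epsilon> * 2 ^ m\<bar>"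
        by (simp only: abs_le_square_iff)
      then show ?thesis using assms by simp
    qed
    have "\<forall>\<^sub>F n in sequentially. 2 ^ m0 \<le> a n"
      by (rule unbounded_mono_on_eventually_ge[OF a_mono a_unbdd])
    moreover have "\<forall>\<^sub>F n in sequentially. n \<ge> 1" by (rule eventually_ge_at_top)
    ultimately show "\<forall>\<^sub>F n in sequentially. \<bar>T n \<omega> - expectation (T n)\<bar> \<le> 2 * \<epsilon> * a n"
    proof eventually_elim
      fix n :: nat assume n: "2 ^ m0 \<le> a n" "n \<ge> 1"
      have "(1::real) \<le> 2 ^ m0" by simp
      then have "1 \<le> a n" using n by linarith
      then obtain m where m: "2 ^ m \<le> a n" "a n < 2 ^ Suc m" by (rule ex_dyadic_bracket)
      have "(2::real) ^ m0 < 2 ^ Suc m" using n m by linarith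
      then have "m \<ge> m0" by (simp only: power_strict_increasing_iff)
      from bracket[OF n(2) m] obtain l h where lh: "l \<in> E m" "h \<in> E m" "l \<le> n" "n \<le> h"
        "\<mu> h \<le> \<mu> n + \<epsilon> * 2 ^ m" "\<mu> n \<le> \<mu> l + \<epsilon> * 2 ^ m" by blast
      \<comment> \<open>Sandwich: \<open>T n - \<mu> n\<close> is at most
        \<open>(T h - \<mu> h) + (\<mu> h - \<mu> n)\<close> and at least
        \<open>(T l - \<mu> l) - (\<mu> n - \<mu> l)\<close>.\<close>
      have "\<bar>T n \<omega> - \<mu> n\<bar> \<le> 2 * (\<epsilon> * 2 ^ m)"
        using end_le[OF \<open>m \<ge> m0\<close> lh(1)] end_le[OF \<open>m \<ge> m0\<close> lh(2)] lh(5,6)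
          T_mono[OF lh(3), of \<omega>] T_mono[OF lh(4), of \<omega>] by linarith
      also have "\<dots> \<le> 2 * (\<epsilon> * a n)" using m assms by simp
      finally show "\<bar>T n \<omega> - expectation (T n)\<bar> \<le> 2 * \<epsilon> * a n" by (simp add: \<mu>_def)
    qed
  qed
qed

lemma AE_truncated_LIMSEQ: "AE \<omega> in M. (\<lambda>n. (T n \<omega> - expectation (T n)) / a n) \<longlonglongrightarrow> 0"
proof -
  \<comment> \<open>Restricting to the values \<open>1 / real (Suc j)\<close> leaves countably many
    exceptional null sets.\<close>
  have "AE \<omega> in M. \<forall>j::nat. \<forall>\<^sub>F n in sequentially.
      \<bar>T n \<omega> - expectation (T n)\<bar> \<le> 2 * (1 / real (Suc j)) * a n"
    unfolding AE_all_countable by (intro allI AE_eventually_truncated_le) simp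
  then show ?thesis
  proof eventually_elim
    fix \<omega> assume *: "\<forall>j::nat. \<forall>\<^sub>F n in sequentially.
      \<bar>T n \<omega> - expectation (T n)\<bar> \<le> 2 * (1 / real (Suc j)) * a n"
    show "(\<lambda>n. (T n \<omega> - expectation (T n)) / a n) \<longlonglongrightarrow> 0"
    proof (rule tendstoI)
      fix e :: real assume "e > 0"
      then obtain j where j: "1 / real (Suc j) < e / 2" using nat_approx_posE[of "e / 2"] by auto
      from *[rule_format, of j] eventually_ge_at_top[of "1::nat"]
      show "\<forall>\<^sub>F n in sequentially. dist ((T n \<omega> - expectation (T n)) / a n) 0 < e"
      proof eventually_elim
        fix n :: nat
        assume n: "\<bar>T n \<omega> - expectation (T n)\<bar> \<le> 2 * (1 / real (Suc j)) * a n" "n \<ge> 1"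
        have "2 * (1 / real (Suc j)) * a n < e * a n"
          using j a_pos[OF n(2)] by (intro mult_strict_right_mono) auto
        then have "\<bar>T n \<omega> - expectation (T n)\<bar> < e * a n" using n(1) by linarith
        then show "dist ((T n \<omega> - expectation (T n)) / a n) 0 < e"
          using a_pos[OF n(2)] by (simp add: dist_real_def abs_divide divide_less_eq)
      qed
    qed
  qed
qed

section \<open>Removing the truncation\<close>

lemma filterlim_a: "filterlim a at_top sequentially"
  unfolding filterlim_at_top using unbounded_mono_on_eventually_ge[OF a_mono a_unbdd] by blast

text \<open>Dominated convergence along integer cut-offs, with \<open>g\<close> on the half-line as
  the dominating function.\<close>

lemma ex_tail_integral_le:
  assumes "e > 0"
  obtains c where "c \<ge> 0" "(\<integral>\<^sup>+x\<in>{c..}. g x \<partial>lborel) \<le> ennreal e"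
proof -
  have "(\<lambda>i. \<integral>\<^sup>+x. g x * indicator {real i..} x \<partial>lborel) \<longlonglongrightarrow> (\<integral>\<^sup>+x. 0 \<partial>(lborel :: real measure))"
  proof (rule nn_integral_dominated_convergence)
    show "AE x in lborel. (\<lambda>i. g x * indicator {real i..} x) \<longlonglongrightarrow> 0"
    proof (rule AE_I2)
      fix x :: real
      have "\<forall>\<^sub>F i in sequentially. real i > x"
        using filterlim_real_sequentially by (auto simp: filterlim_at_top_dense)
      then have "\<forall>\<^sub>F i in sequentially. g x * indicator {real i..} x = 0"
        by eventually_elim auto
      then show "(\<lambda>i. g x * indicator {real i..} x) \<longlonglongrightarrow> 0" by (rule tendsto_eventually)
    qed
  qed (use g_fin in \<open>auto simp: indicator_def\<close>)
  then have "\<forall>\<^sub>F i in sequentially. (\<integral>\<^sup>+x\<in>{real i..}. g x \<partial>lborel) < ennreal e"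
    using assms by (intro order_tendstoD) auto
  then obtain i where "(\<integral>\<^sup>+x\<in>{real i..}. g x \<partial>lborel) < ennreal e"
    by (auto simp: eventually_sequentially)
  then show ?thesis using that[of "real i"] by simp
qed

text \<open>Above the level, \<open>X k = a k + (X k - a k)\<close>; replace the first
  \<open>a k\<close> by the larger \<open>a n\<close> and the second by the smaller
  \<open>c\<close>. The first term then sums to \<open>a n\<close> times a tail of the exceedance
  series, the second to a tail of the integral of \<open>g\<close>.\<close>

lemma truncation_bias_le:
  assumes "1 \<le> k" "k \<le> n" "c \<le> a k"
  shows "expectation (X k) - expectation (Y k) \<le>
    a n * prob {\<omega>\<in>space M. a k < X k \<omega>} + expectation (\<lambda>\<omega>. max 0 (X k \<omega> - c))"
proof -
  have int: "integrable M (X k)" "integrable M (\<lambda>\<omega>. max 0 (X k \<omega> - c))"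
    "integrable M (\<lambda>\<omega>. a n * indicator {\<omega>\<in>space M. a k < X k \<omega>} \<omega>)"
    using integrable_X[OF assms(1)]
    by (auto intro!: integrable_max integrable_mult_right integrable_real_indicator simp: emeasure_eq_measure)
  have ak: "a k \<le> a n" "0 < a k" using assms a_pos by (auto intro: mono_onD[OF a_mono])
  have "expectation (X k) - expectation (Y k) = expectation (\<lambda>\<omega>. X k \<omega> - Y k \<omega>)"
    using int integrable_Y by simp
  also have "\<dots> \<le> expectation (\<lambda>\<omega>. a n * indicator {\<omega>\<in>space M. a k < X k \<omega>} \<omega> + max 0 (X k \<omega> - c))"
  proof (rule integral_mono)
    show "integrable M (\<lambda>\<omega>. X k \<omega> - Y k \<omega>)" using int(1) integrable_Y(1) by (rule Bochner_Integration.integrable_diff)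
    show "integrable M (\<lambda>\<omega>. a n * indicator {\<omega>\<in>space M. a k < X k \<omega>} \<omega> + max 0 (X k \<omega> - c))"
      using int(3,2) by (rule Bochner_Integration.integrable_add)
  qed (use ak assms(3) in \<open>auto simp: Y_def indicator_def\<close>)
  also have "\<dots> = a n * prob {\<omega>\<in>space M. a k < X k \<omega>} + expectation (\<lambda>\<omega>. max 0 (X k \<omega> - c))"
    using int by (subst Bochner_Integration.integral_add) auto
  finally show ?thesis .
qed

text \<open>The biases up to a fixed \<open>N\<close> have a constant sum, negligible against
  \<open>a n\<close>; beyond \<open>N\<close> both terms of \<open>truncation_bias_le\<close> are
  small relative to \<open>a n\<close>.\<close>

lemma truncation_bias_LIMSEQ:
  "(\<lambda>n. ((\<Sum>k=1..n. expectation (X k)) - expectation (T n)) / a n) \<longlonglongrightarrow> 0"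
proof (rule tendstoI)
  fix e0 :: real assume "e0 > 0"
  \<comment> \<open>Three contributions of at most \<open>e * a n\<close> each; a quarter of
    \<open>e0\<close> keeps the final inequality strict.\<close>
  define e where "e = e0 / 4"
  have e: "e > 0" using \<open>e0 > 0\<close> by (simp add: e_def)
  define d where "d k = expectation (X k) - expectation (Y k)" for k
  define p where "p k = prob {\<omega>\<in>space M. a k < X k \<omega>}" for k
  have d0: "0 \<le> d k" if "k \<ge> 1" for k
    unfolding d_def using integrable_X[OF that] integrable_Y Y_bounds by (simp add: integral_mono)
  have sum_d: "(\<Sum>k=1..n. expectation (X k)) - expectation (T n) = (\<Sum>k=1..n. d k)" for n
    by (simp add: expectation_T d_def sum_subtractf)
  obtain c where c: "c \<ge> 0" "(\<integral>\<^sup>+x\<in>{c..}. g x \<partial>lborel) \<le> ennreal e"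
    using ex_tail_integral_le[OF e] .
  have excess: "(\<Sum>k=1..n. expectation (\<lambda>\<omega>. max 0 (X k \<omega> - c))) \<le> a n * e" if "n \<ge> 1" for n
  proof -
    have "ennreal (\<Sum>k=1..n. expectation (\<lambda>\<omega>. max 0 (X k \<omega> - c))) =
      (\<Sum>k=1..n. \<integral>\<^sup>+\<omega>. ennreal (max 0 (X k \<omega> - c)) \<partial>M)"
      using integrable_X
      by (intro sum_nn_integral_eq_integral[symmetric]) (auto intro!: integrable_max)
    also have "\<dots> = (\<Sum>k=1..n. \<integral>\<^sup>+\<omega>. ennreal (X k \<omega> - c) \<partial>M)"
      by (intro sum.cong refl nn_integral_cong) (auto simp: max_def ennreal_neg)
    also have "\<dots> \<le> ennreal (a n) * (\<integral>\<^sup>+x\<in>{c..}. g x \<partial>lborel)"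
      by (rule sum_excess_le[OF that c(1)])
    also have "\<dots> \<le> ennreal (a n) * ennreal e"
      by (rule mult_left_mono[OF c(2)]) simp
    also have "\<dots> = ennreal (a n * e)" using e a_pos[OF that] by (simp add: ennreal_mult)
    finally show ?thesis using e a_pos[OF that] by (simp add: ennreal_le_iff)
  qed
  \<comment> \<open>Cauchy criterion for the exceedance series, whose term number \<open>k\<close>
    is \<open>p (Suc k)\<close>.\<close>
  obtain N1 where N1: "\<And>m n. m \<ge> N1 \<Longrightarrow> (\<Sum>k=Suc m..n. p k) < e"
  proof -
    obtain N where N: "\<And>m n. m \<ge> N \<Longrightarrow> norm (\<Sum>k=m..<n. p (Suc k)) < e"
      using exceed[unfolded summable_Cauchy, rule_format, OF e] unfolding p_def by blast
    have "(\<Sum>k=Suc m..n. p k) < e" if "m \<ge> N" for m n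
    proof -
      have "(\<Sum>k=Suc m..n. p k) = (\<Sum>k=m..<n. p (Suc k))"
        by (simp only: atLeastLessThanSuc_atLeastAtMost[symmetric] sum.shift_bounds_Suc_ivl)
      then show ?thesis using N[OF that, of n] by simp
    qed
    then show ?thesis by (rule that)
  qed
  obtain N2 where N2: "\<And>n. n \<ge> N2 \<Longrightarrow> c \<le> a n"
    using unbounded_mono_on_eventually_ge[OF a_mono a_unbdd, of c] by (auto simp: eventually_sequentially)
  \<comment> \<open>\<open>N1\<close> makes the exceedance tail small, \<open>N2\<close> guarantees
    the hypothesis \<open>c \<le> a k\<close> of the bias bound for \<open>k > N\<close>.\<close>
  define N where "N = max N1 N2"
  define D where "D = (\<Sum>k=1..N. d k)"
  have "(\<lambda>n. D / a n) \<longlonglongrightarrow> 0"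
    by (rule real_tendsto_divide_at_top[OF tendsto_const filterlim_a])
  then have "\<forall>\<^sub>F n in sequentially. D / a n < e" using e by (intro order_tendstoD)
  moreover have "\<forall>\<^sub>F n in sequentially. Suc N \<le> n" by (rule eventually_ge_at_top)
  ultimately show "\<forall>\<^sub>F n in sequentially.
    dist (((\<Sum>k=1..n. expectation (X k)) - expectation (T n)) / a n) 0 < e0"
  proof eventually_elim
    fix n assume n: "D / a n < e" "Suc N \<le> n"
    have an: "a n > 0" using n a_pos by simp
    have "{1..n} = {1..N} \<union> {Suc N..n}" using n by auto
    then have "(\<Sum>k=1..n. d k) = D + (\<Sum>k=Suc N..n. d k)"
      unfolding D_def by (simp add: sum.union_disjoint)
    also have "(\<Sum>k=Suc N..n. d k) \<le> (\<Sum>k=Suc N..n. a n * p k + expectation (\<lambda>\<omega>. max 0 (X k \<omega> - c)))"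
      unfolding d_def p_def using N2 by (intro sum_mono truncation_bias_le) (auto simp: N_def)
    also have "\<dots> = a n * (\<Sum>k=Suc N..n. p k) + (\<Sum>k=Suc N..n. expectation (\<lambda>\<omega>. max 0 (X k \<omega> - c)))"
      by (simp add: sum.distrib sum_distrib_left)
    \<comment> \<open>Non-negative terms are put back because \<open>excess\<close> bounds the sum
      from 1.\<close>
    also have "(\<Sum>k=Suc N..n. expectation (\<lambda>\<omega>. max 0 (X k \<omega> - c))) \<le>
      (\<Sum>k=1..n. expectation (\<lambda>\<omega>. max 0 (X k \<omega> - c)))"
      by (intro sum_mono2) auto
    also have "\<dots> \<le> a n * e" using excess[of n] n by simp
    also have "a n * (\<Sum>k=Suc N..n. p k) \<le> a n * e"
      using N1[of N n] an by (intro mult_left_mono) (auto simp: N_def)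
    also have "D \<le> a n * e" using n an by (simp add: divide_less_eq mult.commute)
    finally have "(\<Sum>k=1..n. d k) \<le> 3 * e * a n" by (simp add: algebra_simps)
    also have "\<dots> < e0 * a n" using an \<open>e0 > 0\<close> by (intro mult_strict_right_mono) (auto simp: e_def)
    finally have "(\<Sum>k=1..n. d k) / a n < e0" using an by (simp add: divide_less_eq)
    moreover have "0 \<le> (\<Sum>k=1..n. d k) / a n"
      using d0 an by (intro divide_nonneg_nonneg sum_nonneg) auto
    ultimately show "dist (((\<Sum>k=1..n. expectation (X k)) - expectation (T n)) / a n) 0 < e0"
      unfolding sum_d by simp
  qed
qed

text \<open>By Borel-Cantelli almost surely \<open>X k = Y k\<close> for all large \<open>k\<close>,
  so the numerator is eventually constant while \<open>a n\<close> tends to infinity.\<close>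

lemma AE_truncation_error_LIMSEQ: "AE \<omega> in M. (\<lambda>n. ((\<Sum>k=1..n. X k \<omega>) - T n \<omega>) / a n) \<longlonglongrightarrow> 0"
proof -
  have "AE \<omega> in M. \<forall>\<^sub>F n in sequentially. \<omega> \<in> space M - {\<omega>\<in>space M. a (Suc n) < X (Suc n) \<omega>}"
    using exceed by (intro borel_cantelli_AE1) (auto simp: emeasure_eq_measure)
  then show ?thesis
  proof eventually_elim
    fix \<omega> assume "\<forall>\<^sub>F n in sequentially. \<omega> \<in> space M - {\<omega>\<in>space M. a (Suc n) < X (Suc n) \<omega>}"
    then obtain N where N: "\<And>n. n \<ge> N \<Longrightarrow> X (Suc n) \<omega> \<le> a (Suc n)"
      by (auto simp: eventually_sequentially not_less)
    have XY: "X k \<omega> = Y k \<omega>" if "k > N" for k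
      using N[of "k - 1"] that by (simp add: Y_def)
    have "(\<lambda>n. (\<Sum>k=1..N. X k \<omega> - Y k \<omega>) / a n) \<longlonglongrightarrow> 0"
      by (rule real_tendsto_divide_at_top[OF tendsto_const filterlim_a])
    moreover have "\<forall>\<^sub>F n in sequentially.
      (\<Sum>k=1..N. X k \<omega> - Y k \<omega>) / a n = ((\<Sum>k=1..n. X k \<omega>) - T n \<omega>) / a n"
      using eventually_ge_at_top[of N]
    proof eventually_elim
      fix n assume "N \<le> n"
      then have "(\<Sum>k=1..N. X k \<omega> - Y k \<omega>) = (\<Sum>k=1..n. X k \<omega> - Y k \<omega>)"
        using XY by (intro sum.mono_neutral_left) auto
      then show "(\<Sum>k=1..N. X k \<omega> - Y k \<omega>) / a n = ((\<Sum>k=1..n. X k \<omega>) - T n \<omega>) / a n"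
        by (simp add: T_def sum_subtractf)
    qed
    ultimately show "(\<lambda>n. ((\<Sum>k=1..n. X k \<omega>) - T n \<omega>) / a n) \<longlonglongrightarrow> 0"
      by (rule Lim_transform_eventually)
  qed
qed

lemma AE_strong_law:
  "AE \<omega> in M. (\<lambda>n. ((\<Sum>k=1..n. X k \<omega>) - (\<Sum>k=1..n. expectation (X k))) / a n) \<longlonglongrightarrow> 0"
  using AE_truncated_LIMSEQ AE_truncation_error_LIMSEQ
proof eventually_elim
  fix \<omega>
  assume "(\<lambda>n. (T n \<omega> - expectation (T n)) / a n) \<longlonglongrightarrow> 0"
    "(\<lambda>n. ((\<Sum>k=1..n. X k \<omega>) - T n \<omega>) / a n) \<longlonglongrightarrow> 0"
  \<comment> \<open>With \<open>S\<close> the untruncated sum: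
    \<open>S - ES = (T - ET) + (S - T) - (ES - ET)\<close>.\<close>
  from tendsto_diff[OF tendsto_add[OF this] truncation_bias_LIMSEQ]
  show "(\<lambda>n. ((\<Sum>k=1..n. X k \<omega>) - (\<Sum>k=1..n. expectation (X k))) / a n) \<longlonglongrightarrow> 0"
    by (simp add: diff_divide_distrib algebra_simps)
qed

end

section \<open>The strong law\<close>

theorem theorem1:
  fixes M :: "'a measure" and X :: "nat \<Rightarrow> 'a \<Rightarrow> real" and a :: "nat \<Rightarrow> real"
  assumes "prob_space M"
    and "\<And>n. n \<ge> 1 \<Longrightarrow> X n \<in> borel_measurable M"
    and "pairwise (\<lambda>i j. prob_space.indep_var M borel (X i) borel (X j)) {1..}"
    and "mono_on {1..} a"
    and "\<not> bdd_above (a ` {1..})"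
    and "\<And>n. n \<ge> 1 \<Longrightarrow> a n > 0"
    and "(\<integral>\<^sup>+ x\<in>{0..}. tail_sup M X a x \<partial>lborel) < \<infinity>"
    and "summable (\<lambda>n. \<P>(\<omega> in M. \<bar>X (Suc n) \<omega>\<bar> > a (Suc n)))"
  shows "AE \<omega> in M.
    (\<lambda>n. (partial_sum X n \<omega> - (\<integral>\<omega>'. partial_sum X n \<omega>' \<partial>M)) / a n) \<longlonglongrightarrow> 0"
proof -
  interpret prob_space M by fact
  note meas = assms(2)
  have tail_meas: "tail_sup M X a \<in> borel_measurable borel"
  proof -
    have "(\<lambda>x. prob {\<omega>\<in>space M. x < \<bar>X k \<omega>\<bar>}) \<in> borel_measurable borel" if "k \<ge> 1" for k
      unfolding measure_def using meas[OF that]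
      by (intro borel_measurable_enn2real borel_measurable_tail) auto
    then show ?thesis
      unfolding tail_sup_def[abs_def]
      by (intro borel_measurable_SUP measurable_compose[OF _ measurable_ennreal]
          borel_measurable_times borel_measurable_sum) auto
  qed
  \<comment> \<open>A general \<open>\<phi>\<close> covers both signed parts at once:
    \<open>\<phi> x \<le> \<bar>x\<bar>\<close> makes every tail of \<open>\<phi> (X k)\<close> at
    most that of the absolute value. Integrability is recorded for splitting the expectation
    below.\<close>
  have law: "(AE \<omega> in M. (\<lambda>n. ((\<Sum>k=1..n. \<phi> (X k \<omega>)) -
        (\<Sum>k=1..n. expectation (\<lambda>\<omega>. \<phi> (X k \<omega>)))) / a n) \<longlonglongrightarrow> 0) \<and>
      (\<forall>k\<ge>1. integrable M (\<lambda>\<omega>. \<phi> (X k \<omega>)))"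
    if \<phi>: "\<And>x. 0 \<le> \<phi> x" "\<And>x. \<phi> x \<le> \<bar>x\<bar>" and [measurable]: "\<phi> \<in> borel_measurable borel"
    for \<phi> :: "real \<Rightarrow> real"
  proof -
    \<comment> \<open>Index 0 is overwritten because nothing is known about \<open>X 0\<close>,
      while the locale asks for measurability and non-negativity at every index.\<close>
    define Z where "Z n \<omega> = (if n = 0 then 0 else \<phi> (X n \<omega>))" for n :: nat and \<omega>
    have Z: "Z n = (\<lambda>\<omega>. \<phi> (X n \<omega>))" if "n \<ge> 1" for n
      using that by (auto simp: Z_def)
    have Z_meas: "Z n \<in> borel_measurable M" for n
      using measurable_compose[OF meas that(3), of n] by (cases "n = 0") (auto simp: Z_def[abs_def])
    have prob_le: "prob {\<omega>\<in>space M. x < Z k \<omega>} \<le> prob {\<omega>\<in>space M. x < \<bar>X k \<omega>\<bar>}" if "k \<ge> 1" for k x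
    proof (rule finite_measure_mono)
      show "{\<omega>\<in>space M. x < Z k \<omega>} \<subseteq> {\<omega>\<in>space M. x < \<bar>X k \<omega>\<bar>}"
        using \<phi>(2) Z[OF that] by (auto intro: less_le_trans)
      show "{\<omega>\<in>space M. x < \<bar>X k \<omega>\<bar>} \<in> events"
        using meas[OF that] by measurable
    qed
    interpret Z: nonneg_tail_dominated M Z a "tail_sup M X a"
    proof unfold_locales
      show "indep_var borel (Z i) borel (Z j)" if "i \<ge> 1" "j \<ge> 1" "i \<noteq> j" for i j
        using indep_var_compose[of borel "X i" borel "X j" \<phi> borel \<phi> borel] that assms(3)
        by (auto simp: Z comp_def pairwise_def)
      show "(\<Sum>k=1..n. emeasure M {\<omega>\<in>space M. x < Z k \<omega>}) \<le> ennreal (a n) * tail_sup M X a x"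
        if "n \<ge> 1" "x \<ge> 0" for n x
      proof -
        let ?s = "\<Sum>k=1..n. prob {\<omega>\<in>space M. x < \<bar>X k \<omega>\<bar>}"
        have "(\<Sum>k=1..n. emeasure M {\<omega>\<in>space M. x < Z k \<omega>}) =
            ennreal (\<Sum>k=1..n. prob {\<omega>\<in>space M. x < Z k \<omega>})"
          by (simp add: emeasure_eq_measure sum_ennreal)
        also have "\<dots> \<le> ennreal ?s"
          using prob_le by (intro ennreal_leI sum_mono) auto
        also have "\<dots> = ennreal (a n) * ennreal (1 / a n * ?s)"
          using assms(6)[OF that(1)] by (simp add: ennreal_mult'[symmetric])
        also have "\<dots> \<le> ennreal (a n) * tail_sup M X a x"
          unfolding tail_sup_def using that by (intro mult_left_mono SUP_upper) auto
        finally show ?thesis .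
      qed
      show "summable (\<lambda>n. prob {\<omega>\<in>space M. a (Suc n) < Z (Suc n) \<omega>})"
        using prob_le by (intro summable_comparison_test[OF _ assms(8)]) auto
    qed (use \<phi> Z_meas tail_meas assms(4-7) in \<open>auto simp: Z_def\<close>)
    have "(\<Sum>k=1..n. Z k \<omega>) = (\<Sum>k=1..n. \<phi> (X k \<omega>))"
      "(\<Sum>k=1..n. expectation (Z k)) = (\<Sum>k=1..n. expectation (\<lambda>\<omega>. \<phi> (X k \<omega>)))" for n \<omega>
      by (auto intro!: sum.cong simp: Z)
    then show ?thesis
      using Z.AE_strong_law Z.integrable_X Z by auto
  qed
  have pos: "(AE \<omega> in M. (\<lambda>n. ((\<Sum>k=1..n. max 0 (X k \<omega>)) -
        (\<Sum>k=1..n. expectation (\<lambda>\<omega>. max 0 (X k \<omega>)))) / a n) \<longlonglongrightarrow> 0) \<and>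
      (\<forall>k\<ge>1. integrable M (\<lambda>\<omega>. max 0 (X k \<omega>)))"
    by (rule law) auto
  have neg: "(AE \<omega> in M. (\<lambda>n. ((\<Sum>k=1..n. max 0 (- X k \<omega>)) -
        (\<Sum>k=1..n. expectation (\<lambda>\<omega>. max 0 (- X k \<omega>)))) / a n) \<longlonglongrightarrow> 0) \<and>
      (\<forall>k\<ge>1. integrable M (\<lambda>\<omega>. max 0 (- X k \<omega>)))"
    by (rule law) auto
  have split: "partial_sum X n \<omega> = (\<Sum>k=1..n. max 0 (X k \<omega>)) - (\<Sum>k=1..n. max 0 (- X k \<omega>))" for n \<omega>
    unfolding partial_sum_def sum_subtractf[symmetric] by (intro sum.cong) auto
  \<comment> \<open>The Bochner integral is 0 by convention on non-integrable functions, so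
    linearity relies on the integrability of both parts obtained from \<open>law\<close>.\<close>
  have E_split: "expectation (partial_sum X n) = (\<Sum>k=1..n. expectation (\<lambda>\<omega>. max 0 (X k \<omega>))) -
      (\<Sum>k=1..n. expectation (\<lambda>\<omega>. max 0 (- X k \<omega>)))" for n
  proof -
    have int: "integrable M (\<lambda>\<omega>. max 0 (X k \<omega>))" "integrable M (\<lambda>\<omega>. max 0 (- X k \<omega>))"
      if "k \<in> {1..n}" for k
      using pos neg that by auto
    have "expectation (partial_sum X n) = expectation (\<lambda>\<omega>. \<Sum>k=1..n. max 0 (X k \<omega>)) -
        expectation (\<lambda>\<omega>. \<Sum>k=1..n. max 0 (- X k \<omega>))"
      unfolding split[abs_def] using int
      by (intro Bochner_Integration.integral_diff Bochner_Integration.integrable_sum)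
    also have "expectation (\<lambda>\<omega>. \<Sum>k=1..n. max 0 (X k \<omega>)) = (\<Sum>k=1..n. expectation (\<lambda>\<omega>. max 0 (X k \<omega>)))"
      by (rule Bochner_Integration.integral_sum[OF int(1)])
    also have "expectation (\<lambda>\<omega>. \<Sum>k=1..n. max 0 (- X k \<omega>)) = (\<Sum>k=1..n. expectation (\<lambda>\<omega>. max 0 (- X k \<omega>)))"
      by (rule Bochner_Integration.integral_sum[OF int(2)])
    finally show ?thesis .
  qed
  from conjunct1[OF pos] conjunct1[OF neg] show ?thesis
  proof eventually_elim
    fix \<omega>
    assume "(\<lambda>n. ((\<Sum>k=1..n. max 0 (X k \<omega>)) -
        (\<Sum>k=1..n. expectation (\<lambda>\<omega>. max 0 (X k \<omega>)))) / a n) \<longlonglongrightarrow> 0"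
      "(\<lambda>n. ((\<Sum>k=1..n. max 0 (- X k \<omega>)) -
        (\<Sum>k=1..n. expectation (\<lambda>\<omega>. max 0 (- X k \<omega>)))) / a n) \<longlonglongrightarrow> 0"
    from tendsto_diff[OF this]
    show "(\<lambda>n. (partial_sum X n \<omega> - expectation (partial_sum X n)) / a n) \<longlonglongrightarrow> 0"
      unfolding E_split split by (simp add: diff_divide_distrib add_divide_distrib algebra_simps)
  qed
qed

end
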